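(* Let $A,A',B,B'$ be join-semilattices with zero, and let $f\colon A\to A'$ and $g\colon B\to B'$ be L-homomorphisms. For a bi-ideal $I$ of $A\times B$, define $$h(I)=\nabla_{A',B'}\cup\{\langle u,v\rangle\in A'\times B' : u\le f(x)\text{ and }v\le g(y)\text{ for some }\langle x,y\rangle\in I\}.$$ Then the following properties hold: (i) $h(I)$ is a bi-ideal of $A'\times B'$. (ii) The map $h$ is a lattice homomorphism from $A\,\overline{\otimes}\,B$ to $A'\,\overline{\otimes}\,B'$. (iii) $h(A\otimes B)\subseteq A'\otimes B'$, and the restriction of $h$ from $A\otimes B$ to $A'\otimes B'$ equals $f\otimes g$. (iv) $f\otimes g$ is an L-homomorphism. (v) $\ker h=\ker f\,\overline{\square}\,\ker g$. Thus $\ker(f\otimes g)=\ker f\,\square\,\ker g$.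
   Context: A $\{\vee,0\}$-homomorphism is a join- and zero-preserving map between join-semilattices with zero. A $\{\vee,0\}$-homomorphism $f\colon A\to B$ is an L-homomorphism if for all $a_0,a_1\in A$ and $b\in B$ with $b\le f(a_0)$ and $b\le f(a_1)$ there exists $x\in A$ such that $x\le a_0$, $x\le a_1$ and $b\le f(x)$. The kernel $\ker f$ of a map is the equivalence relation induced by it; kernels of L-homomorphisms are called L-congruences. Let $\nabla_{A,B}=(A\times\{0\})\cup(\{0\}\times B)$. A bi-ideal of $A\times B$ is a subset $I\subseteq A\times B$ that is hereditary (downward closed), contains $\nabla_{A,B}$, and is closed under lateral joins: if $\langle a_0,b\rangle,\langle a_1,b\rangle\in I$ then $\langle a_0\vee a_1,b\rangle\in I$, and if $\langle a,b_0\rangle,\langle a,b_1\rangle\in I$ then $\langle a,b_0\vee b_1\rangle\in I$. $A\,\overline{\otimes}\,B$ is the (algebraic) lattice of all bi-ideals of $A\times B$ ordered by containment, and $A\otimes B$ is the join-semilattice with zero of its compact elements, generated by the pure tensors $a\otimes b=\nabla_{A,B}\cup\{\langle x,y\rangle: x\le a,\ y\le b\}$. For $\{\vee,0\}$-homomorphisms $f\colon A\to A'$, $g\colon B\to B'$, $f\otimes g\colon A\otimes B\to A'\otimes B'$ is the unique $\{\vee,0\}$-homomorphism with $(f\otimes g)(a\otimes b)=f(a)\otimes g(b)$ for all $a\in A$, $b\in B$. For L-congruences $\alpha$ of $A$ and $\beta$ of $B$, $\alpha\,\overline{\square}\,\beta$ is the binary relation on $A\,\overline{\otimes}\,B$ defined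 by: $H\equiv K$ iff for all $\langle x,y\rangle\in H$ there is $\langle x',y'\rangle\in K$ with $x\equiv_\alpha x'$ and $y\equiv_\beta y'$, and symmetrically with $H$ and $K$ interchanged. $\alpha\,\square\,\beta$ is its restriction to $A\otimes B$. *)

theory Defs
  imports Main
begin

text \<open>
  A join-semilattice with zero is a type of class \<^class>\<open>bounded_semilattice_sup_bot\<close>.
\<close>

definition zero_join_hom ::
  "('a::bounded_semilattice_sup_bot \<Rightarrow> 'b::bounded_semilattice_sup_bot) \<Rightarrow> bool" where
  "zero_join_hom f \<longleftrightarrow> f bot = bot \<and> (\<forall>x y. f (sup x y) = sup (f x) (f y))"

definition L_hom ::
  "('a::bounded_semilattice_sup_bot \<Rightarrow> 'b::bounded_semilattice_sup_bot) \<Rightarrow> bool" where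
  "L_hom f \<longleftrightarrow> zero_join_hom f \<and>
     (\<forall>a0 a1 b. b \<le> f a0 \<and> b \<le> f a1 \<longrightarrow> (\<exists>x. x \<le> a0 \<and> x \<le> a1 \<and> b \<le> f x))"

definition lattice_hom :: "('a::lattice \<Rightarrow> 'b::lattice) \<Rightarrow> bool" where
  "lattice_hom h \<longleftrightarrow>
     (\<forall>x y. h (sup x y) = sup (h x) (h y)) \<and> (\<forall>x y. h (inf x y) = inf (h x) (h y))"

definition ker :: "('a \<Rightarrow> 'b) \<Rightarrow> 'a rel" where
  "ker f = {(x, y). f x = f y}"

definition compact_element :: "'a::complete_lattice \<Rightarrow> bool" where
  "compact_element x \<longleftrightarrow> (\<forall>S. x \<le> Sup S \<longrightarrow> (\<exists>F. finite F \<and> F \<subseteq> S \<and> x \<le> Sup F))"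

lemma zero_join_hom_mono:
  assumes "zero_join_hom f" "x \<le> y"
  shows "f x \<le> f y"
  using assms unfolding zero_join_hom_def by (metis sup.absorb_iff2 sup.cobounded1)

definition nabla :: "('a::bounded_semilattice_sup_bot \<times> 'b::bounded_semilattice_sup_bot) set" where
  "nabla = (UNIV \<times> {bot}) \<union> ({bot} \<times> UNIV)"

definition bi_ideal ::
  "('a::bounded_semilattice_sup_bot \<times> 'b::bounded_semilattice_sup_bot) set \<Rightarrow> bool" where
  "bi_ideal I \<longleftrightarrow>
     (\<forall>a b a' b'. (a, b) \<in> I \<and> a' \<le> a \<and> b' \<le> b \<longrightarrow> (a', b') \<in> I) \<and>
     nabla \<subseteq> I \<and>
     (\<forall>a0 a1 b. (a0, b) \<in> I \<and> (a1, b) \<in> I \<longrightarrow> (sup a0 a1, b) \<in> I) \<and>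
     (\<forall>a b0 b1. (a, b0) \<in> I \<and> (a, b1) \<in> I \<longrightarrow> (a, sup b0 b1) \<in> I)"

lemma bi_ideal_UNIV: "bi_ideal UNIV"
  by (simp add: bi_ideal_def)

lemma bi_ideal_Inter: "(\<And>I. I \<in> C \<Longrightarrow> bi_ideal I) \<Longrightarrow> bi_ideal (\<Inter>C)"
  unfolding bi_ideal_def by blast

lemma bi_ideal_Int: "bi_ideal I \<Longrightarrow> bi_ideal J \<Longrightarrow> bi_ideal (I \<inter> J)"
  using bi_ideal_Inter[of "{I, J}"] by auto

lemma mem_nabla: "(a, b) \<in> nabla \<longleftrightarrow> a = bot \<or> b = bot"
  by (auto simp: nabla_def)

lemma bi_ideal_nabla: "bi_ideal nabla"
  unfolding bi_ideal_def mem_nabla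
proof (intro conjI allI impI)
  fix a a' :: 'a and b b' :: 'b
  assume "(a = bot \<or> b = bot) \<and> a' \<le> a \<and> b' \<le> b"
  then show "a' = bot \<or> b' = bot"
    using le_bot[of a'] le_bot[of b'] by blast
qed (simp, (erule conjE disjE; simp)+)

lemma Inter_bi_ideals: "\<Inter>(Collect bi_ideal) = nabla"
proof (rule antisym)
  show "\<Inter>(Collect bi_ideal) \<subseteq> nabla"
    by (rule Inter_lower) (simp add: bi_ideal_nabla)
  show "nabla \<subseteq> \<Inter>(Collect bi_ideal)"
    by (rule Inter_greatest) (simp add: bi_ideal_def)
qed

text \<open>
  The type \<open>('a, 'b) ext_tensor\<close> is the complete lattice of all bi-ideals of
  \<open>'a \<times> 'b\<close> under containment.
\<close>

typedef (overloaded)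
  ('a::bounded_semilattice_sup_bot, 'b::bounded_semilattice_sup_bot) ext_tensor =
  "{I :: ('a \<times> 'b) set. bi_ideal I}"
  morphisms pairs_of Bi_ideal
  using bi_ideal_UNIV by blast

setup_lifting type_definition_ext_tensor

instantiation ext_tensor ::
  (bounded_semilattice_sup_bot, bounded_semilattice_sup_bot) complete_lattice
begin

lift_definition less_eq_ext_tensor :: "('a, 'b) ext_tensor \<Rightarrow> ('a, 'b) ext_tensor \<Rightarrow> bool"
  is "(\<subseteq>)" .

lift_definition less_ext_tensor :: "('a, 'b) ext_tensor \<Rightarrow> ('a, 'b) ext_tensor \<Rightarrow> bool"
  is "(\<subset>)" .

lift_definition inf_ext_tensor ::
  "('a, 'b) ext_tensor \<Rightarrow> ('a, 'b) ext_tensor \<Rightarrow> ('a, 'b) ext_tensor"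
  is "(\<inter>)" by (rule bi_ideal_Int)

lift_definition sup_ext_tensor ::
  "('a, 'b) ext_tensor \<Rightarrow> ('a, 'b) ext_tensor \<Rightarrow> ('a, 'b) ext_tensor"
  is "\<lambda>I J. \<Inter>{K. bi_ideal K \<and> I \<union> J \<subseteq> K}" by (rule bi_ideal_Inter) simp

lift_definition Inf_ext_tensor :: "('a, 'b) ext_tensor set \<Rightarrow> ('a, 'b) ext_tensor"
  is "\<lambda>C. \<Inter>C" by (rule bi_ideal_Inter)

lift_definition Sup_ext_tensor :: "('a, 'b) ext_tensor set \<Rightarrow> ('a, 'b) ext_tensor"
  is "\<lambda>C. \<Inter>{K. bi_ideal K \<and> \<Union>C \<subseteq> K}" by (rule bi_ideal_Inter) simp

lift_definition bot_ext_tensor :: "('a, 'b) ext_tensor" is nabla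
  by (rule bi_ideal_nabla)

lift_definition top_ext_tensor :: "('a, 'b) ext_tensor" is UNIV
  by (rule bi_ideal_UNIV)

instance
proof
  fix x y z :: "('a, 'b) ext_tensor" and A :: "('a, 'b) ext_tensor set"
  show "x < y \<longleftrightarrow> x \<le> y \<and> \<not> y \<le> x" by transfer auto
  show "x \<le> x" by transfer simp
  show "x \<le> y \<Longrightarrow> y \<le> z \<Longrightarrow> x \<le> z" by transfer simp
  show "x \<le> y \<Longrightarrow> y \<le> x \<Longrightarrow> x = y" by transfer simp
  show "inf x y \<le> x" by transfer simp
  show "inf x y \<le> y" by transfer simp
  show "x \<le> y \<Longrightarrow> x \<le> z \<Longrightarrow> x \<le> inf y z" by transfer simp
  show "x \<le> sup x y" by transfer auto
  show "y \<le> sup x y" by transfer auto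
  show "y \<le> x \<Longrightarrow> z \<le> x \<Longrightarrow> sup y z \<le> x" by transfer (simp add: Inter_lower)
  show "x \<in> A \<Longrightarrow> Inf A \<le> x" by transfer (simp add: Inter_lower)
  show "(\<And>x. x \<in> A \<Longrightarrow> z \<le> x) \<Longrightarrow> z \<le> Inf A" by transfer (simp add: Inter_greatest)
  show "x \<in> A \<Longrightarrow> x \<le> Sup A" by transfer auto
  show "(\<And>x. x \<in> A \<Longrightarrow> x \<le> z) \<Longrightarrow> Sup A \<le> z"
    by transfer (simp add: Inter_lower Union_least)
  show "Inf {} = (top :: ('a, 'b) ext_tensor)" by transfer simp
  show "Sup {} = (bot :: ('a, 'b) ext_tensor)"
    by transfer (simp add: Inter_bi_ideals)
qed

end

lemmas ext_le_iff = less_eq_ext_tensor.rep_eq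

lemma bi_ideal_pairs_of: "bi_ideal (pairs_of I)"
  using pairs_of[of I] by simp

lemma
  assumes "bi_ideal I"
  shows bi_ideal_down: "(a, b) \<in> I \<Longrightarrow> a' \<le> a \<Longrightarrow> b' \<le> b \<Longrightarrow> (a', b') \<in> I"
    and bi_ideal_nabla_subset: "nabla \<subseteq> I"
    and bi_ideal_sup_left: "(a0, b) \<in> I \<Longrightarrow> (a1, b) \<in> I \<Longrightarrow> (sup a0 a1, b) \<in> I"
    and bi_ideal_sup_right: "(a, b0) \<in> I \<Longrightarrow> (a, b1) \<in> I \<Longrightarrow> (a, sup b0 b1) \<in> I"
  using assms unfolding bi_ideal_def by blast+

text \<open>Joins of bi-ideals are finitary.\<close>

lemma pairs_of_Sup:
  fixes S :: "('a::bounded_semilattice_sup_bot, 'b::bounded_semilattice_sup_bot) ext_tensor set"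
  shows "pairs_of (Sup S) = (\<Union>F \<in> {F. finite F \<and> F \<subseteq> S}. pairs_of (Sup F))"
proof -
  define U where "U = (\<Union>F \<in> {F. finite F \<and> F \<subseteq> S}. pairs_of (Sup F))"
  have mem_U: "p \<in> U \<longleftrightarrow> (\<exists>F. finite F \<and> F \<subseteq> S \<and> p \<in> pairs_of (Sup F))" for p
    unfolding U_def by auto
  have mono: "pairs_of (Sup F) \<subseteq> pairs_of (Sup G)" if "F \<subseteq> G"
    for F G :: "('a, 'b) ext_tensor set"
    using Sup_subset_mono[OF that] by (simp only: ext_le_iff)
  have dir: "\<exists>F. finite F \<and> F \<subseteq> S \<and> p \<in> pairs_of (Sup F) \<and> q \<in> pairs_of (Sup F)"
    if p: "p \<in> U" and q: "q \<in> U" for p q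
  proof -
    obtain F where F: "finite F" "F \<subseteq> S" "p \<in> pairs_of (Sup F)"
      using p mem_U by auto
    obtain G where G: "finite G" "G \<subseteq> S" "q \<in> pairs_of (Sup G)"
      using q mem_U by auto
    show ?thesis
      using F G mono[of F "F \<union> G"] mono[of G "F \<union> G"] by (intro exI[of _ "F \<union> G"]) auto
  qed
  have "bi_ideal U"
    unfolding bi_ideal_def
  proof (intro conjI allI impI)
    show "(a', b') \<in> U" if ab: "(a, b) \<in> U \<and> a' \<le> a \<and> b' \<le> b" for a b a' b'
    proof -
      obtain F where "finite F" "F \<subseteq> S" "(a, b) \<in> pairs_of (Sup F)"
        using ab mem_U by auto
      then show ?thesis
        using ab bi_ideal_down[OF bi_ideal_pairs_of] mem_U by blast
    qed
    show "nabla \<subseteq> U"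
      using bi_ideal_nabla_subset[OF bi_ideal_pairs_of, of "Sup {}"] mem_U
      by (meson empty_subsetI finite.emptyI subset_iff)
    show "(sup a0 a1, b) \<in> U" if ab: "(a0, b) \<in> U \<and> (a1, b) \<in> U" for a0 a1 b
    proof -
      obtain F where "finite F" "F \<subseteq> S" "(a0, b) \<in> pairs_of (Sup F)" "(a1, b) \<in> pairs_of (Sup F)"
        using ab dir[of "(a0, b)" "(a1, b)"] by auto
      then show ?thesis
        using bi_ideal_sup_left[OF bi_ideal_pairs_of] mem_U by blast
    qed
    show "(a, sup b0 b1) \<in> U" if ab: "(a, b0) \<in> U \<and> (a, b1) \<in> U" for a b0 b1
    proof -
      obtain F where "finite F" "F \<subseteq> S" "(a, b0) \<in> pairs_of (Sup F)" "(a, b1) \<in> pairs_of (Sup F)"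
        using ab dir[of "(a, b0)" "(a, b1)"] by auto
      then show ?thesis
        using bi_ideal_sup_right[OF bi_ideal_pairs_of] mem_U by blast
    qed
  qed
  then have rep: "pairs_of (Bi_ideal U) = U"
    by (simp add: Bi_ideal_inverse)
  have "Sup S \<le> Bi_ideal U"
  proof (rule Sup_least)
    fix I assume "I \<in> S"
    then have "pairs_of (Sup {I}) \<subseteq> U"
      unfolding U_def by (intro UN_upper) simp
    then show "I \<le> Bi_ideal U"
      by (simp add: ext_le_iff rep)
  qed
  then have "pairs_of (Sup S) \<subseteq> U"
    by (simp only: ext_le_iff rep)
  moreover have "U \<subseteq> pairs_of (Sup S)"
    unfolding U_def using mono by (intro UN_least) simp
  ultimately show ?thesis
    unfolding U_def by (rule antisym)
qed

lemma compact_element_bot: "compact_element (bot :: 'a::complete_lattice)"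
  unfolding compact_element_def by (auto intro!: exI[of _ "{}"])

lemma compact_element_sup:
  fixes x y :: "'a::complete_lattice"
  assumes "compact_element x" "compact_element y"
  shows "compact_element (sup x y)"
  unfolding compact_element_def
proof (intro allI impI)
  fix S assume "sup x y \<le> Sup S"
  then have le: "x \<le> Sup S" "y \<le> Sup S" by simp_all
  obtain F where F: "finite F" "F \<subseteq> S" "x \<le> Sup F"
    using assms(1) le(1) unfolding compact_element_def by blast
  obtain G where G: "finite G" "G \<subseteq> S" "y \<le> Sup G"
    using assms(2) le(2) unfolding compact_element_def by blast
  have "sup x y \<le> Sup (F \<union> G)"
    unfolding Sup_union_distrib using F(3) G(3) by (rule sup_mono)
  with F G show "\<exists>F. finite F \<and> F \<subseteq> S \<and> sup x y \<le> Sup F"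
    by (intro exI[of _ "F \<union> G"]) simp
qed

text \<open>
  The type \<open>('a, 'b) tensor\<close> is the join-semilattice with zero of the compact bi-ideals
  of \<open>'a \<times> 'b\<close>.
\<close>

typedef (overloaded)
  ('a::bounded_semilattice_sup_bot, 'b::bounded_semilattice_sup_bot) tensor =
  "{I :: ('a, 'b) ext_tensor. compact_element I}"
  morphisms ext_of Compact
  using compact_element_bot by blast

setup_lifting type_definition_tensor

instantiation tensor ::
  (bounded_semilattice_sup_bot, bounded_semilattice_sup_bot) bounded_semilattice_sup_bot
begin

lift_definition less_eq_tensor :: "('a, 'b) tensor \<Rightarrow> ('a, 'b) tensor \<Rightarrow> bool"
  is "(\<le>)" .

lift_definition less_tensor :: "('a, 'b) tensor \<Rightarrow> ('a, 'b) tensor \<Rightarrow> bool"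
  is "(<)" .

lift_definition sup_tensor :: "('a, 'b) tensor \<Rightarrow> ('a, 'b) tensor \<Rightarrow> ('a, 'b) tensor"
  is sup by (rule compact_element_sup)

lift_definition bot_tensor :: "('a, 'b) tensor" is bot
  by (rule compact_element_bot)

instance
proof
  fix x y z :: "('a, 'b) tensor"
  show "x < y \<longleftrightarrow> x \<le> y \<and> \<not> y \<le> x" by transfer (rule less_le_not_le)
  show "x \<le> x" by transfer simp
  show "x \<le> y \<Longrightarrow> y \<le> z \<Longrightarrow> x \<le> z" by transfer (rule order_trans)
  show "x \<le> y \<Longrightarrow> y \<le> x \<Longrightarrow> x = y" by transfer (rule antisym)
  show "x \<le> sup x y" by transfer simp
  show "y \<le> sup x y" by transfer simp
  show "y \<le> x \<Longrightarrow> z \<le> x \<Longrightarrow> sup y z \<le> x" by transfer simp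
  show "bot \<le> x" by transfer simp
qed

end

lemma bi_ideal_pure: "bi_ideal (nabla \<union> {(x, y). x \<le> a \<and> y \<le> b})"
proof -
  have mem: "(x, y) \<in> nabla \<union> {(x, y). x \<le> a \<and> y \<le> b} \<longleftrightarrow>
      x = bot \<or> y = bot \<or> (x \<le> a \<and> y \<le> b)" for x y
    by (simp add: mem_nabla)
  show ?thesis
    unfolding bi_ideal_def mem
  proof (intro conjI allI impI)
    fix x x' y y'
    assume "(x = bot \<or> y = bot \<or> (x \<le> a \<and> y \<le> b)) \<and> x' \<le> x \<and> y' \<le> y"
    then show "x' = bot \<or> y' = bot \<or> (x' \<le> a \<and> y' \<le> b)"
      using le_bot[of x'] le_bot[of y'] order_trans[of x' x a] order_trans[of y' y b] by blast
  next
    fix x0 x1 y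
    assume "(x0 = bot \<or> y = bot \<or> (x0 \<le> a \<and> y \<le> b)) \<and>
      (x1 = bot \<or> y = bot \<or> (x1 \<le> a \<and> y \<le> b))"
    then show "sup x0 x1 = bot \<or> y = bot \<or> (sup x0 x1 \<le> a \<and> y \<le> b)"
      by (elim conjE disjE) simp_all
  next
    fix x y0 y1
    assume "(x = bot \<or> y0 = bot \<or> (x \<le> a \<and> y0 \<le> b)) \<and>
      (x = bot \<or> y1 = bot \<or> (x \<le> a \<and> y1 \<le> b))"
    then show "x = bot \<or> sup y0 y1 = bot \<or> (x \<le> a \<and> sup y0 y1 \<le> b)"
      by (elim conjE disjE) simp_all
  qed simp
qed

lift_definition pure_ext ::
  "'a::bounded_semilattice_sup_bot \<Rightarrow> 'b::bounded_semilattice_sup_bot \<Rightarrow> ('a, 'b) ext_tensor"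
  is "\<lambda>a b. nabla \<union> {(x, y). x \<le> a \<and> y \<le> b}"
  by (rule bi_ideal_pure)

lemma pure_ext_le_iff: "pure_ext a b \<le> I \<longleftrightarrow> (a, b) \<in> pairs_of I"
proof
  assume "pure_ext a b \<le> I"
  then show "(a, b) \<in> pairs_of I"
    by (auto simp: ext_le_iff pure_ext.rep_eq)
next
  assume "(a, b) \<in> pairs_of I"
  then show "pure_ext a b \<le> I"
    using bi_ideal_nabla_subset[OF bi_ideal_pairs_of, of I]
      bi_ideal_down[OF bi_ideal_pairs_of, of a b I]
    by (auto simp: ext_le_iff pure_ext.rep_eq)
qed

lemma compact_element_pure_ext: "compact_element (pure_ext a b)"
  unfolding compact_element_def pure_ext_le_iff by (subst pairs_of_Sup) auto

lift_definition pure_tensor ::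
  "'a::bounded_semilattice_sup_bot \<Rightarrow> 'b::bounded_semilattice_sup_bot \<Rightarrow> ('a, 'b) tensor"
  is pure_ext by (rule compact_element_pure_ext)

lemma ext_tensor_eq_Sup: "I = Sup ((\<lambda>(a, b). pure_ext a b) ` pairs_of I)"
proof (rule antisym)
  have "(a, b) \<in> pairs_of (Sup ((\<lambda>(a, b). pure_ext a b) ` pairs_of I))"
    if "(a, b) \<in> pairs_of I" for a b
    unfolding pure_ext_le_iff[symmetric] using that by (intro Sup_upper) force
  then show "I \<le> Sup ((\<lambda>(a, b). pure_ext a b) ` pairs_of I)"
    by (auto simp: ext_le_iff)
  show "Sup ((\<lambda>(a, b). pure_ext a b) ` pairs_of I) \<le> I"
    by (rule Sup_least) (auto simp: pure_ext_le_iff)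
qed

text \<open>The pure tensors generate the tensor product.\<close>

lemma tensor_induct:
  assumes "P bot" "\<And>a b. P (pure_tensor a b)" "\<And>s t. P s \<Longrightarrow> P t \<Longrightarrow> P (sup s t)"
  shows "P t"
proof -
  let ?p = "\<lambda>(a, b). pure_ext a b"
  have fin: "\<exists>s. ext_of s = Sup (?p ` F) \<and> P s" if "finite F" for F
    using that
  proof induction
    case empty
    show ?case using assms(1) by (intro exI[of _ bot]) (simp add: bot_tensor.rep_eq)
  next
    case (insert q F)
    then obtain s where "ext_of s = Sup (?p ` F)" "P s" by blast
    moreover obtain a b where "q = (a, b)" by fastforce
    ultimately show ?case
      using assms(2,3)
      by (intro exI[of _ "sup (pure_tensor a b) s"])
        (simp add: sup_tensor.rep_eq pure_tensor.rep_eq)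
  qed
  have "compact_element (ext_of t)" using ext_of by blast
  moreover have "ext_of t \<le> Sup (?p ` pairs_of (ext_of t))"
    using ext_tensor_eq_Sup[of "ext_of t"] by simp
  ultimately obtain G where "finite G" "G \<subseteq> ?p ` pairs_of (ext_of t)" "ext_of t \<le> Sup G"
    unfolding compact_element_def by blast
  then obtain F where F: "finite F" "F \<subseteq> pairs_of (ext_of t)" "ext_of t \<le> Sup (?p ` F)"
    by (metis finite_subset_image)
  have "Sup (?p ` F) \<le> ext_of t"
    by (rule Sup_least) (use F(2) in \<open>auto simp: pure_ext_le_iff\<close>)
  with F(3) have "ext_of t = Sup (?p ` F)" by simp
  with fin[OF F(1)] show ?thesis by (metis ext_of_inject)
qed

definition tensor_map ::
  "('a::bounded_semilattice_sup_bot \<Rightarrow> 'c::bounded_semilattice_sup_bot) \<Rightarrow>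
   ('b::bounded_semilattice_sup_bot \<Rightarrow> 'd::bounded_semilattice_sup_bot) \<Rightarrow>
   ('a, 'b) tensor \<Rightarrow> ('c, 'd) tensor" where
  "tensor_map f g =
     (THE p. zero_join_hom p \<and> (\<forall>a b. p (pure_tensor a b) = pure_tensor (f a) (g b)))"

lemma tensor_map_ex1:
  fixes f :: "'a::bounded_semilattice_sup_bot \<Rightarrow> 'c::bounded_semilattice_sup_bot"
    and g :: "'b::bounded_semilattice_sup_bot \<Rightarrow> 'd::bounded_semilattice_sup_bot"
  assumes f: "zero_join_hom f" and g: "zero_join_hom g"
  shows "\<exists>!p. zero_join_hom p \<and> (\<forall>a b. p (pure_tensor a b) = pure_tensor (f a) (g b))"
proof -
  define pre :: "('c, 'd) ext_tensor \<Rightarrow> ('a, 'b) ext_tensor"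
    where "pre J = Bi_ideal {(x, y). (f x, g y) \<in> pairs_of J}" for J
  define \<phi> :: "('a, 'b) ext_tensor \<Rightarrow> ('c, 'd) ext_tensor"
    where "\<phi> I = Inf {J. I \<le> pre J}" for I
  have "bi_ideal {(x, y). (f x, g y) \<in> pairs_of J}" for J :: "('c, 'd) ext_tensor"
    unfolding bi_ideal_def
  proof (intro conjI allI impI)
    note J = bi_ideal_pairs_of[of J]
    show "nabla \<subseteq> {(x, y). (f x, g y) \<in> pairs_of J}"
      using bi_ideal_nabla_subset[OF J] f g by (auto simp: nabla_def zero_join_hom_def)
    show "(a', b') \<in> {(x, y). (f x, g y) \<in> pairs_of J}"
      if "(a, b) \<in> {(x, y). (f x, g y) \<in> pairs_of J} \<and> a' \<le> a \<and> b' \<le> b" for a b a' b'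
      using that bi_ideal_down[OF J, of "f a" "g b" "f a'" "g b'"]
        zero_join_hom_mono[OF f] zero_join_hom_mono[OF g] by simp
    show "(sup a0 a1, b) \<in> {(x, y). (f x, g y) \<in> pairs_of J}"
      if "(a0, b) \<in> {(x, y). (f x, g y) \<in> pairs_of J} \<and>
        (a1, b) \<in> {(x, y). (f x, g y) \<in> pairs_of J}" for a0 a1 b
      using that bi_ideal_sup_left[OF J] f by (simp add: zero_join_hom_def)
    show "(a, sup b0 b1) \<in> {(x, y). (f x, g y) \<in> pairs_of J}"
      if "(a, b0) \<in> {(x, y). (f x, g y) \<in> pairs_of J} \<and>
        (a, b1) \<in> {(x, y). (f x, g y) \<in> pairs_of J}" for a b0 b1
      using that bi_ideal_sup_right[OF J] g by (simp add: zero_join_hom_def)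
  qed
  then have pairs_pre: "pairs_of (pre J) = {(x, y). (f x, g y) \<in> pairs_of J}" for J
    by (simp add: pre_def Bi_ideal_inverse)
  have adj: "\<phi> I \<le> J \<longleftrightarrow> I \<le> pre J" for I J
  proof
    have "I \<le> pre (Inf {J. I \<le> pre J})"
      by (auto simp: ext_le_iff pairs_pre Inf_ext_tensor.rep_eq)
    moreover assume "\<phi> I \<le> J"
    ultimately show "I \<le> pre J"
      by (auto simp: \<phi>_def ext_le_iff pairs_pre)
  qed (auto simp: \<phi>_def intro: Inf_lower)
  have \<phi>_le_iff: "\<phi> (sup I J) \<le> K \<longleftrightarrow> sup (\<phi> I) (\<phi> J) \<le> K" for I J K
    by (simp add: adj)
  have \<phi>_sup: "\<phi> (sup I J) = sup (\<phi> I) (\<phi> J)" for I J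
    by (rule antisym) (use \<phi>_le_iff[of I J] in auto)
  have \<phi>_bot: "\<phi> bot = bot"
    using adj[of bot bot] by (simp add: bot_unique)
  have \<phi>_pure_le_iff: "\<phi> (pure_ext a b) \<le> K \<longleftrightarrow> pure_ext (f a) (g b) \<le> K" for a b K
    by (simp add: adj pure_ext_le_iff pairs_pre)
  have \<phi>_pure: "\<phi> (pure_ext a b) = pure_ext (f a) (g b)" for a b
    by (rule antisym) (use \<phi>_pure_le_iff[of a b] in auto)
  have cpt: "compact_element (\<phi> (ext_of t))" for t
  proof (induction t rule: tensor_induct)
    case 1
    then show ?case by (simp add: bot_tensor.rep_eq \<phi>_bot compact_element_bot)
  next
    case (2 a b)
    then show ?case by (simp add: pure_tensor.rep_eq \<phi>_pure compact_element_pure_ext)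
  next
    case (3 s t)
    then show ?case by (simp add: sup_tensor.rep_eq \<phi>_sup compact_element_sup)
  qed
  show ?thesis
  proof (rule ex_ex1I)
    define p where "p t = Compact (\<phi> (ext_of t))" for t
    have ext_p: "ext_of (p t) = \<phi> (ext_of t)" for t
      using cpt by (simp add: p_def Compact_inverse)
    have "zero_join_hom p \<and> (\<forall>a b. p (pure_tensor a b) = pure_tensor (f a) (g b))"
      by (simp add: zero_join_hom_def ext_p \<phi>_sup \<phi>_bot \<phi>_pure bot_tensor.rep_eq sup_tensor.rep_eq
          pure_tensor.rep_eq flip: ext_of_inject)
    then show "\<exists>p. zero_join_hom p \<and> (\<forall>a b. p (pure_tensor a b) = pure_tensor (f a) (g b))"
      by blast
  next
    fix p q
    assume p: "zero_join_hom p \<and> (\<forall>a b. p (pure_tensor a b) = pure_tensor (f a) (g b))"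
      and q: "zero_join_hom q \<and> (\<forall>a b. q (pure_tensor a b) = pure_tensor (f a) (g b))"
    show "p = q"
    proof
      show "p t = q t" for t
        by (induction t rule: tensor_induct) (use p q in \<open>simp_all add: zero_join_hom_def\<close>)
    qed
  qed
qed

definition ext_box ::
  "'a::bounded_semilattice_sup_bot rel \<Rightarrow> 'b::bounded_semilattice_sup_bot rel \<Rightarrow>
   ('a, 'b) ext_tensor rel" where
  "ext_box \<alpha> \<beta> = {(H, K).
     (\<forall>(x, y) \<in> pairs_of H. \<exists>(x', y') \<in> pairs_of K. (x, x') \<in> \<alpha> \<and> (y, y') \<in> \<beta>) \<and>
     (\<forall>(x, y) \<in> pairs_of K. \<exists>(x', y') \<in> pairs_of H. (x, x') \<in> \<alpha> \<and> (y, y') \<in> \<beta>)}"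

definition box ::
  "'a::bounded_semilattice_sup_bot rel \<Rightarrow> 'b::bounded_semilattice_sup_bot rel \<Rightarrow>
   ('a, 'b) tensor rel" where
  "box \<alpha> \<beta> = {(s, t). (ext_of s, ext_of t) \<in> ext_box \<alpha> \<beta>}"

definition h_set ::
  "('a::bounded_semilattice_sup_bot \<Rightarrow> 'c::bounded_semilattice_sup_bot) \<Rightarrow>
   ('b::bounded_semilattice_sup_bot \<Rightarrow> 'd::bounded_semilattice_sup_bot) \<Rightarrow>
   ('a \<times> 'b) set \<Rightarrow> ('c \<times> 'd) set" where
  "h_set f g I = nabla \<union> {(u, v). \<exists>(x, y) \<in> I. u \<le> f x \<and> v \<le> g y}"

text \<open>
  The value of \<open>h_map\<close> is meaningful only where \<^const>\<open>h_set\<close> yields a bi-ideal,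
  as it does on bi-ideals when \<open>f\<close> and \<open>g\<close> are L-homomorphisms.
\<close>

definition h_map ::
  "('a::bounded_semilattice_sup_bot \<Rightarrow> 'c::bounded_semilattice_sup_bot) \<Rightarrow>
   ('b::bounded_semilattice_sup_bot \<Rightarrow> 'd::bounded_semilattice_sup_bot) \<Rightarrow>
   ('a, 'b) ext_tensor \<Rightarrow> ('c, 'd) ext_tensor" where
  "h_map f g I = Bi_ideal (h_set f g (pairs_of I))"

end

theory Submission
  imports Defs
begin

text \<open>
  The L-property lets two witnesses for membership in \<open>h(I)\<close> be cut down to a common one: if
  \<open>v \<le> g y0\<close> and \<open>v \<le> g y1\<close>, then \<open>v \<le> g y\<close> for some \<open>y \<le> y0, y1\<close>. This makes \<open>h(I)\<close> closed
  under lateral joins (\<open>bi_ideal_h_set\<close>), makes \<open>h\<close> preserve binary meets (\<open>h_map_inf\<close>), and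
  turns \<open>f x \<le> f x'\<close> into \<open>f x = f x''\<close> for some \<open>x'' \<le> x'\<close> (\<open>L_hom_le_imp_eq\<close>), which is what
  the description of the kernel requires.

  Since \<open>h(I)\<close> is then the least bi-ideal containing the image of \<open>I\<close> under \<open>f \<times> g\<close>, the map \<open>h\<close>
  is left adjoint to the preimage map (\<open>h_map_le_iff_le_pullback\<close>) and so preserves all joins.
  It sends \<open>a \<otimes> b\<close> to \<open>f a \<otimes> g b\<close>, hence agrees with \<open>f \<otimes> g\<close> on compact bi-ideals.
  Finally, if a compact \<open>s\<close> lies below \<open>h(I)\<close> and \<open>h(J)\<close>, it lies below \<open>h(I \<inter> J)\<close>, which is
  the join of the bi-ideals \<open>f a \<otimes> g b\<close> over \<open>(a, b) \<in> I \<inter> J\<close>. By compactness finitely many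
  pairs suffice, and the join of the corresponding \<open>a \<otimes> b\<close> witnesses that \<open>f \<otimes> g\<close> is an
  L-homomorphism.
\<close>

section \<open>Common refinements of witnesses\<close>

lemma L_hom_zero_join_hom: "L_hom f \<Longrightarrow> zero_join_hom f"
  by (simp add: L_hom_def)

lemma L_homE:
  assumes "L_hom f" "b \<le> f a0" "b \<le> f a1"
  obtains x where "x \<le> a0" "x \<le> a1" "b \<le> f x"
  using assms unfolding L_hom_def by blast

lemma L_hom_le_imp_eq:
  assumes f: "L_hom f" and le: "f x \<le> f x'"
  obtains x'' where "x'' \<le> x'" "f x'' = f x"
proof -
  obtain x'' where x'': "x'' \<le> x" "x'' \<le> x'" "f x \<le> f x''"
    using L_homE[OF f order_refl le] .
  moreover have "f x'' \<le> f x"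
    using zero_join_hom_mono[OF L_hom_zero_join_hom[OF f] x''(1)] .
  ultimately show thesis
    using that by (metis antisym)
qed

section \<open>The image bi-ideal\<close>

lemma mem_h_set_iff:
  "(u, v) \<in> h_set f g I \<longleftrightarrow>
     u = bot \<or> v = bot \<or> (\<exists>x y. (x, y) \<in> I \<and> u \<le> f x \<and> v \<le> g y)"
  by (auto simp: h_set_def mem_nabla)

lemma bi_ideal_h_set:
  assumes f: "L_hom f" and g: "L_hom g" and I: "bi_ideal I"
  shows "bi_ideal (h_set f g I)"
proof -
  have f_sup: "f (sup x y) = sup (f x) (f y)" for x y
    using f by (simp add: L_hom_def zero_join_hom_def)
  have g_sup: "g (sup x y) = sup (g x) (g y)" for x y
    using g by (simp add: L_hom_def zero_join_hom_def)
  show ?thesis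
    unfolding bi_ideal_def
  proof (intro conjI allI impI)
    show "(u', v') \<in> h_set f g I" if "(u, v) \<in> h_set f g I \<and> u' \<le> u \<and> v' \<le> v" for u v u' v'
      using that unfolding mem_h_set_iff by (metis bot_unique order_trans)
    show "nabla \<subseteq> h_set f g I"
      by (simp add: h_set_def)
    show "(sup u0 u1, v) \<in> h_set f g I"
      if uv: "(u0, v) \<in> h_set f g I \<and> (u1, v) \<in> h_set f g I" for u0 u1 v
    proof (cases "u0 = bot \<or> u1 = bot \<or> v = bot")
      case True
      then show ?thesis using uv by (auto simp: mem_h_set_iff)
    next
      case False
      with uv obtain x0 y0 x1 y1 where
        0: "(x0, y0) \<in> I" "u0 \<le> f x0" "v \<le> g y0" and
        1: "(x1, y1) \<in> I" "u1 \<le> f x1" "v \<le> g y1"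
        unfolding mem_h_set_iff by blast
      obtain y where y: "y \<le> y0" "y \<le> y1" "v \<le> g y"
        using L_homE[OF g 0(3) 1(3)] .
      have "(sup x0 x1, y) \<in> I"
        using bi_ideal_down[OF I 0(1) order_refl y(1)] bi_ideal_down[OF I 1(1) order_refl y(2)]
        by (rule bi_ideal_sup_left[OF I])
      moreover have "sup u0 u1 \<le> f (sup x0 x1)"
        unfolding f_sup using 0(2) 1(2) by (rule sup_mono)
      ultimately show ?thesis
        using y(3) unfolding mem_h_set_iff by blast
    qed
    show "(u, sup v0 v1) \<in> h_set f g I"
      if uv: "(u, v0) \<in> h_set f g I \<and> (u, v1) \<in> h_set f g I" for u v0 v1
    proof (cases "v0 = bot \<or> v1 = bot \<or> u = bot")
      case True
      then show ?thesis using uv by (auto simp: mem_h_set_iff)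
    next
      case False
      with uv obtain x0 y0 x1 y1 where
        0: "(x0, y0) \<in> I" "u \<le> f x0" "v0 \<le> g y0" and
        1: "(x1, y1) \<in> I" "u \<le> f x1" "v1 \<le> g y1"
        unfolding mem_h_set_iff by blast
      obtain x where x: "x \<le> x0" "x \<le> x1" "u \<le> f x"
        using L_homE[OF f 0(2) 1(2)] .
      have "(x, sup y0 y1) \<in> I"
        using bi_ideal_down[OF I 0(1) x(1) order_refl] bi_ideal_down[OF I 1(1) x(2) order_refl]
        by (rule bi_ideal_sup_right[OF I])
      moreover have "sup v0 v1 \<le> g (sup y0 y1)"
        unfolding g_sup using 0(3) 1(3) by (rule sup_mono)
      ultimately show ?thesis
        using x(3) unfolding mem_h_set_iff by blast
    qed
  qed
qed

lemma pairs_of_h_map: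
  assumes "L_hom f" "L_hom g"
  shows "pairs_of (h_map f g I) = h_set f g (pairs_of I)"
  unfolding h_map_def
  by (rule Bi_ideal_inverse) (simp add: bi_ideal_h_set[OF assms bi_ideal_pairs_of])

lemma h_map_le_iff:
  assumes "L_hom f" "L_hom g"
  shows "h_map f g I \<le> J \<longleftrightarrow> (\<forall>x y. (x, y) \<in> pairs_of I \<longrightarrow> (f x, g y) \<in> pairs_of J)"
proof
  assume "h_map f g I \<le> J"
  then show "\<forall>x y. (x, y) \<in> pairs_of I \<longrightarrow> (f x, g y) \<in> pairs_of J"
    unfolding ext_le_iff pairs_of_h_map[OF assms] using mem_h_set_iff[of _ _ f g] by blast
next
  assume *: "\<forall>x y. (x, y) \<in> pairs_of I \<longrightarrow> (f x, g y) \<in> pairs_of J"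
  have "(u, v) \<in> pairs_of J" if "(u, v) \<in> h_set f g (pairs_of I)" for u v
    using that * bi_ideal_down[OF bi_ideal_pairs_of]
      bi_ideal_nabla_subset[OF bi_ideal_pairs_of, of J]
    unfolding mem_h_set_iff by (meson mem_nabla subsetD)
  then show "h_map f g I \<le> J"
    unfolding ext_le_iff pairs_of_h_map[OF assms] by auto
qed

section \<open>Joins and meets\<close>

text \<open>
  The preimage of a bi-ideal under \<open>f \<times> g\<close>. The value is meaningful only where
  that preimage is a bi-ideal, as it is when \<open>f\<close> and \<open>g\<close> preserve joins and zero.
\<close>

definition pullback ::
  "('a::bounded_semilattice_sup_bot \<Rightarrow> 'c::bounded_semilattice_sup_bot) \<Rightarrow>
   ('b::bounded_semilattice_sup_bot \<Rightarrow> 'd::bounded_semilattice_sup_bot) \<Rightarrow>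
   ('c, 'd) ext_tensor \<Rightarrow> ('a, 'b) ext_tensor" where
  "pullback f g J = Bi_ideal {(x, y). (f x, g y) \<in> pairs_of J}"

lemma bi_ideal_vimage:
  assumes f: "zero_join_hom f" and g: "zero_join_hom g" and J: "bi_ideal J"
  shows "bi_ideal {(x, y). (f x, g y) \<in> J}"
  unfolding bi_ideal_def
proof (intro conjI allI impI)
  show "nabla \<subseteq> {(x, y). (f x, g y) \<in> J}"
    using bi_ideal_nabla_subset[OF J] f g by (auto simp: nabla_def zero_join_hom_def)
qed (use bi_ideal_down[OF J] bi_ideal_sup_left[OF J] bi_ideal_sup_right[OF J] f g
    zero_join_hom_mono[OF f] zero_join_hom_mono[OF g] in
    \<open>auto simp: zero_join_hom_def\<close>)

lemma h_map_le_iff_le_pullback: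
  assumes "L_hom f" "L_hom g"
  shows "h_map f g I \<le> J \<longleftrightarrow> I \<le> pullback f g J"
proof -
  have "pairs_of (pullback f g J) = {(x, y). (f x, g y) \<in> pairs_of J}"
    unfolding pullback_def using assms
    by (simp add: Bi_ideal_inverse bi_ideal_vimage L_hom_zero_join_hom bi_ideal_pairs_of)
  then show ?thesis
    unfolding h_map_le_iff[OF assms] by (auto simp: ext_le_iff)
qed

lemma h_map_Sup:
  assumes "L_hom f" "L_hom g"
  shows "h_map f g (Sup S) = Sup (h_map f g ` S)"
proof -
  have "h_map f g (Sup S) \<le> J \<longleftrightarrow> Sup (h_map f g ` S) \<le> J" for J
    by (simp add: h_map_le_iff_le_pullback[OF assms] Sup_le_iff)
  then show ?thesis
    by (metis antisym order_refl)
qed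

lemma h_map_sup:
  assumes "L_hom f" "L_hom g"
  shows "h_map f g (sup I J) = sup (h_map f g I) (h_map f g J)"
  using h_map_Sup[OF assms, of "{I, J}"] by simp

lemma h_map_bot:
  assumes "L_hom f" "L_hom g"
  shows "h_map f g bot = bot"
  using h_map_Sup[OF assms, of "{}"] by simp

lemma h_map_inf:
  assumes f: "L_hom f" and g: "L_hom g"
  shows "h_map f g (inf I J) = inf (h_map f g I) (h_map f g J)"
proof -
  have "(u, v) \<in> h_set f g (pairs_of I \<inter> pairs_of J) \<longleftrightarrow>
      (u, v) \<in> h_set f g (pairs_of I) \<inter> h_set f g (pairs_of J)" for u v
  proof
    assume uv: "(u, v) \<in> h_set f g (pairs_of I) \<inter> h_set f g (pairs_of J)"
    show "(u, v) \<in> h_set f g (pairs_of I \<inter> pairs_of J)"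
    proof (cases "u = bot \<or> v = bot")
      case False
      with uv obtain x0 y0 x1 y1 where
        0: "(x0, y0) \<in> pairs_of I" "u \<le> f x0" "v \<le> g y0" and
        1: "(x1, y1) \<in> pairs_of J" "u \<le> f x1" "v \<le> g y1"
        unfolding Int_iff mem_h_set_iff by blast
      obtain x where x: "x \<le> x0" "x \<le> x1" "u \<le> f x"
        using L_homE[OF f 0(2) 1(2)] .
      obtain y where y: "y \<le> y0" "y \<le> y1" "v \<le> g y"
        using L_homE[OF g 0(3) 1(3)] .
      have "(x, y) \<in> pairs_of I \<inter> pairs_of J"
        using bi_ideal_down[OF bi_ideal_pairs_of 0(1) x(1) y(1)]
          bi_ideal_down[OF bi_ideal_pairs_of 1(1) x(2) y(2)] by simp
      then show ?thesis
        using x(3) y(3) unfolding mem_h_set_iff by blast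
    qed (auto simp: mem_h_set_iff)
  qed (auto simp: mem_h_set_iff)
  then have "h_set f g (pairs_of I \<inter> pairs_of J) =
      h_set f g (pairs_of I) \<inter> h_set f g (pairs_of J)"
    by auto
  then show ?thesis
    by (simp add: pairs_of_h_map[OF f g] inf_ext_tensor.rep_eq flip: pairs_of_inject)
qed

section \<open>Compact bi-ideals\<close>

lemma h_map_pure_ext:
  assumes "L_hom f" "L_hom g"
  shows "h_map f g (pure_ext a b) = pure_ext (f a) (g b)"
proof (rule antisym)
  have "(f x, g y) \<in> pairs_of (pure_ext (f a) (g b))"
    if "(x, y) \<in> pairs_of (pure_ext a b)" for x y
    using that assms zero_join_hom_mono[of f x a] zero_join_hom_mono[of g y b]
    by (auto simp: pure_ext.rep_eq mem_nabla L_hom_def zero_join_hom_def)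
  then show "h_map f g (pure_ext a b) \<le> pure_ext (f a) (g b)"
    by (simp add: h_map_le_iff[OF assms])
  show "pure_ext (f a) (g b) \<le> h_map f g (pure_ext a b)"
    unfolding pure_ext_le_iff pairs_of_h_map[OF assms] mem_h_set_iff
    by (auto simp: pure_ext.rep_eq)
qed

lemma
  assumes "zero_join_hom f" "zero_join_hom g"
  shows zero_join_hom_tensor_map: "zero_join_hom (tensor_map f g)"
    and tensor_map_pure_tensor: "tensor_map f g (pure_tensor a b) = pure_tensor (f a) (g b)"
  using theI'[OF tensor_map_ex1[OF assms]] unfolding tensor_map_def by blast+

lemma h_map_ext_of:
  assumes "L_hom f" "L_hom g"
  shows "h_map f g (ext_of t) = ext_of (tensor_map f g t)"
proof -
  note fg = L_hom_zero_join_hom[OF assms(1)] L_hom_zero_join_hom[OF assms(2)]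
  note hom = zero_join_hom_tensor_map[OF fg, unfolded zero_join_hom_def]
  show ?thesis
  proof (induction t rule: tensor_induct)
    case 1
    then show ?case using hom by (simp add: bot_tensor.rep_eq h_map_bot[OF assms])
  next
    case (2 a b)
    then show ?case
      by (simp add: pure_tensor.rep_eq h_map_pure_ext[OF assms] tensor_map_pure_tensor[OF fg])
  next
    case (3 s t)
    then show ?case using hom by (simp add: sup_tensor.rep_eq h_map_sup[OF assms])
  qed
qed

lemma compact_element_h_map:
  assumes "L_hom f" "L_hom g" "compact_element I"
  shows "compact_element (h_map f g I)"
  using h_map_ext_of[OF assms(1,2), of "Compact I"] ext_of[of "tensor_map f g (Compact I)"] assms(3)
  by (simp add: Compact_inverse)

lemma compact_element_Sup:
  fixes S :: "'a::complete_lattice set"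
  assumes "finite S" "\<And>x. x \<in> S \<Longrightarrow> compact_element x"
  shows "compact_element (Sup S)"
  using assms by induction (simp_all add: compact_element_bot compact_element_sup)

lemma L_hom_tensor_map:
  fixes f :: "'a::bounded_semilattice_sup_bot \<Rightarrow> 'c::bounded_semilattice_sup_bot"
    and g :: "'b::bounded_semilattice_sup_bot \<Rightarrow> 'd::bounded_semilattice_sup_bot"
  assumes "L_hom f" "L_hom g"
  shows "L_hom (tensor_map f g)"
  unfolding L_hom_def
proof (intro conjI allI impI)
  show "zero_join_hom (tensor_map f g)"
    using assms by (intro zero_join_hom_tensor_map L_hom_zero_join_hom)
  fix t0 t1 and s :: "('c, 'd) tensor"
  assume s: "s \<le> tensor_map f g t0 \<and> s \<le> tensor_map f g t1"
  let ?p = "\<lambda>(a, b). pure_ext a b"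
  define M where "M = inf (ext_of t0) (ext_of t1)"
  have "ext_of s \<le> h_map f g M"
    using s by (simp add: M_def h_map_inf[OF assms] h_map_ext_of[OF assms] less_eq_tensor.rep_eq)
  also have "\<dots> = Sup (h_map f g ` ?p ` pairs_of M)"
    by (subst ext_tensor_eq_Sup) (rule h_map_Sup[OF assms])
  finally obtain G where "finite G" "G \<subseteq> h_map f g ` ?p ` pairs_of M" "ext_of s \<le> Sup G"
    using ext_of[of s] unfolding compact_element_def by blast
  then obtain F where F: "finite F" "F \<subseteq> ?p ` pairs_of M" "ext_of s \<le> Sup (h_map f g ` F)"
    by (metis finite_subset_image)
  have "compact_element (Sup F)"
    by (rule compact_element_Sup) (use F(1,2) in \<open>auto simp: compact_element_pure_ext\<close>)
  then have t: "ext_of (Compact (Sup F)) = Sup F"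
    by (simp add: Compact_inverse)
  have "Sup F \<le> M"
    by (rule Sup_least) (use F(2) in \<open>auto simp: pure_ext_le_iff\<close>)
  then have "Compact (Sup F) \<le> t0" "Compact (Sup F) \<le> t1"
    by (simp_all add: less_eq_tensor.rep_eq t M_def)
  moreover have "s \<le> tensor_map f g (Compact (Sup F))"
    using F(3) by (simp add: less_eq_tensor.rep_eq t h_map_Sup[OF assms] flip: h_map_ext_of[OF assms])
  ultimately show "\<exists>x. x \<le> t0 \<and> x \<le> t1 \<and> s \<le> tensor_map f g x"
    by blast
qed

section \<open>Kernels\<close>

lemma h_map_le_imp_ker_witness:
  assumes f: "L_hom f" and g: "L_hom g"
    and le: "h_map f g H \<le> h_map f g K" and xy: "(x, y) \<in> pairs_of H"
  obtains x' y' where "(x', y') \<in> pairs_of K" "f x = f x'" "g y = g y'"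
proof -
  have "f bot = bot" "g bot = bot"
    using f g by (simp_all add: L_hom_def zero_join_hom_def)
  \<comment> \<open>If \<open>f x\<close> or \<open>g y\<close> is zero, the pair \<open>(f x, g y)\<close> may lie in \<open>h(K)\<close> only through
    \<open>nabla\<close>; these pairs of \<open>K\<close> serve then.\<close>
  have nabla: "(bot, y) \<in> pairs_of K" "(x, bot) \<in> pairs_of K"
    using bi_ideal_nabla_subset[OF bi_ideal_pairs_of, of K] by (auto simp: nabla_def)
  have "(f x, g y) \<in> h_set f g (pairs_of K)"
    using le xy unfolding h_map_le_iff[OF f g] pairs_of_h_map[OF f g] by blast
  then consider "f x = bot" | "g y = bot"
    | x1 y1 where "(x1, y1) \<in> pairs_of K" "f x \<le> f x1" "g y \<le> g y1"
    unfolding mem_h_set_iff by blast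
  then show thesis
  proof cases
    case 1
    then show ?thesis using that[OF nabla(1)] \<open>f bot = bot\<close> by simp
  next
    case 2
    then show ?thesis using that[OF nabla(2)] \<open>g bot = bot\<close> by simp
  next
    case 3
    obtain x' where "x' \<le> x1" "f x' = f x"
      using L_hom_le_imp_eq[OF f 3(2)] .
    moreover obtain y' where "y' \<le> y1" "g y' = g y"
      using L_hom_le_imp_eq[OF g 3(3)] .
    ultimately show ?thesis
      using that bi_ideal_down[OF bi_ideal_pairs_of 3(1)] by metis
  qed
qed

lemma ker_witness_imp_h_map_le:
  assumes "L_hom f" "L_hom g"
    and "\<And>x y. (x, y) \<in> pairs_of H \<Longrightarrow> \<exists>(x', y') \<in> pairs_of K. f x = f x' \<and> g y = g y'"
  shows "h_map f g H \<le> h_map f g K"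
  unfolding h_map_le_iff[OF assms(1,2)] pairs_of_h_map[OF assms(1,2)] mem_h_set_iff
  using assms(3) by fastforce

lemma ker_h_map:
  assumes "L_hom f" "L_hom g"
  shows "ker (h_map f g) = ext_box (ker f) (ker g)"
proof -
  have "h_map f g H \<le> h_map f g K \<longleftrightarrow>
      (\<forall>(x, y) \<in> pairs_of H. \<exists>(x', y') \<in> pairs_of K. (x, x') \<in> ker f \<and> (y, y') \<in> ker g)" for H K
  proof
    assume le: "h_map f g H \<le> h_map f g K"
    show "\<forall>(x, y) \<in> pairs_of H. \<exists>(x', y') \<in> pairs_of K. (x, x') \<in> ker f \<and> (y, y') \<in> ker g"
    proof clarify
      fix x y assume "(x, y) \<in> pairs_of H"
      then obtain x' y' where "(x', y') \<in> pairs_of K" "f x = f x'" "g y = g y'"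
        using h_map_le_imp_ker_witness[OF assms le] by blast
      then show "\<exists>(x', y') \<in> pairs_of K. (x, x') \<in> ker f \<and> (y, y') \<in> ker g"
        by (auto simp: ker_def)
    qed
  next
    assume "\<forall>(x, y) \<in> pairs_of H. \<exists>(x', y') \<in> pairs_of K. (x, x') \<in> ker f \<and> (y, y') \<in> ker g"
    then show "h_map f g H \<le> h_map f g K"
      by (intro ker_witness_imp_h_map_le[OF assms]) (auto simp: ker_def)
  qed
  then show ?thesis
    unfolding ext_box_def ker_def[of "h_map f g"] order_eq_iff[of "h_map f g _"] by simp
qed

lemma ker_tensor_map:
  assumes "L_hom f" "L_hom g"
  shows "ker (tensor_map f g) = box (ker f) (ker g)"
  unfolding box_def ker_h_map[OF assms, symmetric]
  by (simp add: ker_def h_map_ext_of[OF assms] ext_of_inject)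

theorem lemma3p6:
  fixes f :: "'a::bounded_semilattice_sup_bot \<Rightarrow> 'c::bounded_semilattice_sup_bot"
    and g :: "'b::bounded_semilattice_sup_bot \<Rightarrow> 'd::bounded_semilattice_sup_bot"
  assumes "L_hom f" and "L_hom g"
  shows
    "(\<forall>I. bi_ideal I \<longrightarrow> bi_ideal (h_set f g I)) \<and>
     lattice_hom (h_map f g) \<and>
     ((\<forall>I. compact_element I \<longrightarrow> compact_element (h_map f g I)) \<and>
      (\<forall>t. h_map f g (ext_of t) = ext_of (tensor_map f g t))) \<and>
     L_hom (tensor_map f g) \<and>
     (ker (h_map f g) = ext_box (ker f) (ker g) \<and>
      ker (tensor_map f g) = box (ker f) (ker g))"
  using assms
  by (simp add: bi_ideal_h_set lattice_hom_def h_map_sup h_map_inf compact_element_h_map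
      h_map_ext_of L_hom_tensor_map ker_h_map ker_tensor_map)

end
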